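(* For $m\ge1$ let $N_m=m(m+1)/2$, and let $$\nu_m=\frac1{N_m}\sum_{\Psi_m(\alpha)=0}\delta_{\alpha},$$ where the sum is over the complex zeros $\alpha$ of $\Psi_m$ counted with multiplicity. Then, as $m\to\infty$, $\nu_m$ converges in the weak-$*$ sense to the normalized Haar measure $\frac{d\theta}{2\pi}$ on the unit circle $\mathbb T=\{|q|=1\}$. Equivalently, for every fixed arc $I\subset\mathbb T$ of length $|I|$ (with or without endpoints), $$\frac1{N_m}\#\{\alpha:\Psi_m(\alpha)=0,\ \arg\alpha\in I\}\longrightarrow\frac{|I|}{2\pi}\qquad(m\to\infty),$$ and for every fixed $\varepsilon>0$ all but $o(N_m)$ zeros $\alpha$ of $\Psi_m$ satisfy $1-\varepsilon<|\alpha|<1+\varepsilon$ (zeros counted with multiplicity throughout).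
   Context: $\Psi_m$ is the polynomial $$\Psi_m(q)=\sum_{k=0}^{m}(-1)^k(2k+1)q^{k(k+1)/2},$$ of degree $N_m=m(m+1)/2$. The measures $\nu_m$ are probability measures on $\mathbb C$, and the limit is regarded as a measure on $\mathbb C$ supported on $\mathbb T$. The condition $\arg\alpha\in I$ means $\alpha/|\alpha|\in I$. *)

theory Defs
  imports
    "HOL-Probability.Probability"
    "HOL-Computational_Algebra.Fundamental_Theorem_Algebra"
    "HOL-Library.Landau_Symbols"
begin

definition Psi :: "nat \<Rightarrow> complex poly" where
  "Psi m = (\<Sum>k=0..m. monom ((-1) ^ k * of_nat (2 * k + 1)) (k * (k + 1) div 2))"

definition Psi_deg :: "nat \<Rightarrow> nat" where
  "Psi_deg m = m * (m + 1) div 2"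

(* The multiset proots p lists the zeros with multiplicity, and return borel \<alpha> is the
   Dirac measure at \<alpha>.  For m = 0 the factor 1 / Psi_deg m is junk;
   only m \<ge> 1 is meaningful. *)
definition zero_measure :: "nat \<Rightarrow> complex measure" where
  "zero_measure m = measure_of UNIV (sets borel)
     (\<lambda>A. (\<Sum>\<alpha>\<in>#proots (Psi m). emeasure (return borel \<alpha>) A) / of_nat (Psi_deg m))"

(* d\<theta> / (2 pi), regarded as a measure on the complex plane. *)
definition circle_haar :: "complex measure" where
  "circle_haar = distr (uniform_measure lborel {0..<2 * pi}) borel cis"

(* Test functions are all bounded continuous functions, which include those that are compactly
   supported or vanish at infinity.  For probability measures with a probability measure
   as limit, all three classes give the same notion of convergence. *)
definition weak_star_converges :: "(nat \<Rightarrow> complex measure) \<Rightarrow> complex measure \<Rightarrow> bool" where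
  "weak_star_converges M L \<longleftrightarrow>
     (\<forall>f :: complex \<Rightarrow> real. continuous_on UNIV f \<and> bounded (range f) \<longrightarrow>
        (\<lambda>m. \<integral>z. f z \<partial>M m) \<longlonglongrightarrow> (\<integral>z. f z \<partial>L))"

definition circle_arc :: "complex set \<Rightarrow> real \<Rightarrow> bool" where
  "circle_arc I l \<longleftrightarrow>
     (\<exists>a b. a \<le> b \<and> b \<le> a + 2 * pi \<and> l = b - a \<and>
        I \<in> (`) cis ` {{a..b}, {a<..b}, {a..<b}, {a<..<b}})"

(* The number of zeros, with multiplicity, that satisfy P. *)
definition zero_count :: "nat \<Rightarrow> (complex \<Rightarrow> bool) \<Rightarrow> nat" where
  "zero_count m P = size (filter_mset P (proots (Psi m)))"

lemma triangle_strict_mono: "i < j \<Longrightarrow> i * (i + 1) div 2 < j * (j + 1) div (2::nat)"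
proof -
  assume "i < j"
  then have "(i + 1) * (i + 2) \<le> j * (j + 1)"
    by (intro mult_mono) auto
  moreover have "i * (i + 1) + 2 \<le> (i + 1) * (i + 2)"
    by (simp add: algebra_simps)
  ultimately have "i * (i + 1) + 2 \<le> j * (j + 1)"
    by (rule order.trans[rotated])
  then have "(i * (i + 1) + 2) div 2 \<le> j * (j + 1) div 2"
    by (rule div_le_mono)
  then show ?thesis by simp
qed

lemma degree_Psi: "degree (Psi m) = Psi_deg m"
proof (rule antisym)
  show "degree (Psi m) \<le> Psi_deg m"
    unfolding Psi_def Psi_deg_def
    by (intro degree_sum_le order.trans[OF degree_monom_le])
       (auto intro!: div_le_mono add_mono mult_mono)
  have "coeff (Psi m) (Psi_deg m) =
      (\<Sum>k=0..m. if k = m then (-1) ^ k * of_nat (2 * k + 1) else 0)"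
    unfolding Psi_def Psi_deg_def coeff_sum coeff_monom
  proof (intro sum.cong refl)
    fix k assume "k \<in> {0..m}"
    then have "k = m \<or> k * (k + 1) div 2 < m * (m + 1) div 2"
      using triangle_strict_mono[of k m] by fastforce
    then show "(if k * (k + 1) div 2 = m * (m + 1) div 2
        then (-1) ^ k * of_nat (2 * k + 1) else (0::complex)) =
      (if k = m then (-1) ^ k * of_nat (2 * k + 1) else 0)"
      by auto
  qed
  also have "\<dots> = (-1) ^ m * of_nat (2 * m + 1)"
    by simp
  also have "\<dots> \<noteq> 0"
    using of_nat_eq_0_iff[where 'a = complex, of "2 * m + 1"]
    by (simp del: of_nat_Suc of_nat_add of_nat_mult)
  finally show "Psi_deg m \<le> degree (Psi m)"
    by (rule le_degree)
qed

lemma sets_zero_measure [simp, measurable_cong]: "sets (zero_measure m) = sets borel"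
  unfolding zero_measure_def
  by (simp add: sets_measure_of_conv sets.sigma_sets_eq[of borel, simplified])

lemma space_zero_measure [simp]: "space (zero_measure m) = UNIV"
  using sets_eq_imp_space_eq[OF sets_zero_measure[of m]] by simp

lemma emeasure_zero_measure:
  assumes "A \<in> sets borel"
  shows "emeasure (zero_measure m) A =
    (\<Sum>\<alpha>\<in>#proots (Psi m). emeasure (return borel \<alpha>) A) / of_nat (Psi_deg m)"
proof (rule emeasure_measure_of[OF zero_measure_def])
  let ?\<mu> = "\<lambda>A. (\<Sum>\<alpha>\<in>#proots (Psi m). emeasure (return borel \<alpha>) A) / of_nat (Psi_deg m)"
  show "positive (sets (zero_measure m)) ?\<mu>"
    by (simp add: positive_def)
  show "countably_additive (sets (zero_measure m)) ?\<mu>"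
  proof (rule countably_additiveI)
    fix B :: "nat \<Rightarrow> complex set"
    assume B: "range B \<subseteq> sets (zero_measure m)" "disjoint_family B"
    have "(\<Sum>i. \<Sum>\<alpha>\<in>#X. emeasure (return borel \<alpha>) (B i)) =
        (\<Sum>\<alpha>\<in>#X. emeasure (return borel \<alpha>) (\<Union> (range B)))" for X
    proof (induction X)
      case (add x X)
      have "(\<Sum>i. emeasure (return borel x) (B i)) = emeasure (return borel x) (\<Union> (range B))"
        using B by (intro suminf_emeasure) auto
      with add show ?case by (simp add: suminf_add[symmetric])
    qed simp
    then show "(\<Sum>i. ?\<mu> (B i)) = ?\<mu> (\<Union> (range B))"
      by (simp add: divide_ennreal_def)
  qed
qed (use assms in auto)

lemma prob_space_zero_measure:
  assumes "m \<ge> 1"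
  shows "prob_space (zero_measure m)"
proof
  have "Psi_deg m \<noteq> 0"
    using triangle_strict_mono[of 0 m] assms by (simp add: Psi_deg_def)
  moreover have "(\<Sum>\<alpha>\<in>#X. emeasure (return borel \<alpha>) (UNIV :: complex set)) = of_nat (size X)" for X
    by (induction X) auto
  ultimately show "emeasure (zero_measure m) (space (zero_measure m)) = 1"
    by (simp add: emeasure_zero_measure size_proots_complex degree_Psi ennreal_divide_self
        of_nat_less_top)
qed

lemma prob_space_circle_haar: "prob_space circle_haar"
proof -
  have cis: "cis \<in> borel_measurable borel"
    by (intro borel_measurable_continuous_onI continuous_intros)
  interpret prob_space "uniform_measure lborel {0..<2 * pi}"
    by (rule prob_space_uniform_measure) auto
  show ?thesis
    unfolding circle_haar_def
    by (rule prob_space_distr)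
       (use cis in \<open>simp add: measurable_def uniform_measure_def\<close>)
qed

end

theory Submission
  imports
    Defs
    "HOL-Complex_Analysis.Conformal_Mappings"
    "HOL-Computational_Algebra.Polynomial_FPS"
    "HOL-Real_Asymp.Real_Asymp"
begin

text \<open>
The zeros equidistribute because \<open>\<Psi>\<^sub>m\<close> has tiny coefficients for its degree: it is bounded by
\<open>(m + 1)\<^sup>2\<close> on the unit circle, its constant coefficient is \<open>1\<close>, its leading
coefficient has modulus at least \<open>1\<close>, and its degree \<open>N\<close> grows like \<open>m\<^sup>2 / 2\<close>. This is the
setting of the theorem of Erdos and Turan. As no rate of convergence is asked for, the following
argument suffices.

\<^item> \<^emph>\<open>Radii.\<close> By Jensen's inequality the Mahler measure of a polynomial is at most its maximum on
the unit circle. Together with the sizes of the constant and the leading coefficient this bounds both the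
product of the \<open>|\<alpha>|\<close> over the zeros outside the disc and the product of the \<open>1 / |\<alpha>|\<close> over
those inside, so that only \<open>O(log m)\<close> of the \<open>N\<close> zeros avoid a given annulus around the circle
(lemma \<open>off_circle_roots_count\<close>).

\<^item> \<^emph>\<open>Arguments.\<close> By Newton's identities the power sum \<open>\<Sum> \<alpha>\<^sup>-\<^sup>k\<close> is determined by the first
\<open>k\<close> nonconstant coefficients, which are bounded independently of \<open>m\<close>; hence it is \<open>O(1)\<close>, and \<open>o(N)\<close> in
particular (lemma \<open>inverse_power_sums_bounded\<close>). All zeros have modulus at least \<open>1/6\<close>, so
the terms of this sum are bounded, and almost all of them are close to \<open>(\<alpha> / |\<alpha>|)\<^sup>-\<^sup>k\<close> (lemma
\<open>avg_diff_sgn_tendsto_0\<close>). So all nontrivial moments of the normalised zeros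
\<open>\<alpha> / |\<alpha>|\<close> tend to \<open>0\<close>, and by Weyl's criterion (lemma \<open>weyl_criterion_circle\<close>) these are
equidistributed on the circle.

Weak convergence for the zeros themselves follows by comparing \<open>f \<alpha>\<close> with \<open>f (\<alpha> / |\<alpha>|)\<close>
once more, and the counts in arcs follow by the usual approximation of indicator functions from above
by continuous functions, applied to an arc and to its complement.
\<close>

section \<open>Averages over multisets\<close>

text \<open>
All limits below concern normalised sums over finite multisets of zeros. Proportions are the averages of
0-1-valued functions, so that one set of rules serves counts, moments and test functions.
\<close>
definition avg :: "('a \<Rightarrow> 'b :: real_normed_field) \<Rightarrow> 'a multiset \<Rightarrow> 'b" where
  "avg f A = (\<Sum>x\<in>#A. f x) / of_nat (size A)"

lemma avg_cong: "(\<And>x. x \<in># A \<Longrightarrow> f x = g x) \<Longrightarrow> avg f A = avg g A"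
  unfolding avg_def by (metis (mono_tags, lifting) image_mset_cong)

lemma avg_add: "avg (\<lambda>x. f x + g x) A = avg f A + avg g A"
  by (simp add: avg_def sum_mset.distrib add_divide_distrib)

lemma avg_cmult: "avg (\<lambda>x. c * f x) A = c * avg f A"
  by (simp add: avg_def sum_mset_distrib_left)

lemma avg_diff: "avg (\<lambda>x. f x - g x) A = avg f A - avg g A"
  using avg_add[of f "\<lambda>x. -1 * g x" A] by (simp only: avg_cmult) simp

lemma avg_sum: "avg (\<lambda>x. \<Sum>i\<in>I. f i x) A = (\<Sum>i\<in>I. avg (f i) A)"
proof (induction I rule: infinite_finite_induct)
  case (insert i I)
  then show ?case by (simp add: avg_add)
qed (simp_all add: avg_def)

lemma avg_const: "A \<noteq> {#} \<Longrightarrow> avg (\<lambda>_. c) A = c"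
  by (simp add: avg_def)

lemma avg_mono:
  fixes f :: "'a \<Rightarrow> real"
  assumes "\<And>x. x \<in># A \<Longrightarrow> f x \<le> g x"
  shows "avg f A \<le> avg g A"
  using assms by (auto simp: avg_def intro!: divide_right_mono sum_mset_mono)

lemma norm_avg_le:
  assumes "\<And>x. x \<in># A \<Longrightarrow> norm (f x) \<le> g x"
  shows "norm (avg f A) \<le> avg g A"
proof -
  have "norm (\<Sum>x\<in>#A. f x) \<le> (\<Sum>x\<in>#A. g x)"
    using assms
  proof (induction A)
    case (add x A)
    then show ?case
      using norm_triangle_ineq[of "f x" "\<Sum>x\<in>#A. f x"] by fastforce
  qed simp
  then show ?thesis
    by (simp add: avg_def norm_divide divide_right_mono)
qed

lemma avg_of_bool: "avg (\<lambda>x. of_bool (P x)) A = real (size (filter_mset P A)) / real (size A)"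
proof -
  have "(\<Sum>x\<in>#A. of_bool (P x)) = real (size (filter_mset P A))"
    by (induction A) auto
  then show ?thesis by (simp add: avg_def)
qed

lemma avg_of_real: "avg (\<lambda>x. complex_of_real (f x)) A = of_real (avg f A)"
proof -
  have "(\<Sum>x\<in>#A. complex_of_real (f x)) = of_real (\<Sum>x\<in>#A. f x)"
    by (induction A) auto
  then show ?thesis by (simp add: avg_def)
qed

lemma avg_cnj: "avg (\<lambda>x. cnj (f x)) A = cnj (avg f A)"
proof -
  have "(\<Sum>x\<in>#A. cnj (f x)) = cnj (\<Sum>x\<in>#A. f x)"
    by (induction A) auto
  then show ?thesis by (simp add: avg_def)
qed

lemma avg_image_mset: "avg f (image_mset g A) = avg (\<lambda>x. f (g x)) A"
  by (simp add: avg_def image_mset.compositionality o_def)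

section \<open>Zeros of a polynomial with small values on the unit circle\<close>

lemma root_nonzero: "coeff p 0 \<noteq> 0 \<Longrightarrow> a \<in># proots p \<Longrightarrow> a \<noteq> 0"
  by (cases "p = 0") (auto simp: poly_0_coeff_0)

lemma coeff_0_eq_prod_roots:
  fixes p :: "complex poly"
  shows "coeff p 0 = lead_coeff p * (\<Prod>a\<in>#proots p. - a)"
proof -
  have "coeff (\<Prod>a\<in>#A. [:- a, 1:]) 0 = (\<Prod>a\<in>#A. - a)" for A :: "complex multiset"
    by (induction A) (simp_all add: coeff_mult_0 del: mult_pCons_left)
  then show ?thesis
    by (subst complex_poly_decompose_multiset[of p, symmetric]) simp
qed

text \<open>
This is Jensen's inequality. Reflecting the zeros inside the disc, that is, replacing \<open>z - a\<close> by
\<open>1 - cnj a * z\<close>, does not change the modulus on the unit circle, and it turns the value at \<open>0\<close>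
into the left-hand side; the maximum principle compares the two.
\<close>
lemma mahler_measure_le_max_on_circle:
  fixes p :: "complex poly"
  assumes M: "\<And>z. cmod z = 1 \<Longrightarrow> cmod (poly p z) \<le> M"
  shows "cmod (lead_coeff p) * (\<Prod>a\<in>#proots p. max 1 (cmod a)) \<le> M"
proof -
  define fac where "fac = (\<lambda>a z :: complex. if cmod a < 1 then 1 - cnj a * z else z - a)"
  define Q where "Q = (\<lambda>z. lead_coeff p * (\<Prod>a\<in>#proots p. fac a z))"
  have fac_circle: "cmod (fac a z) = cmod (z - a)" if "cmod z = 1" for a z
  proof (cases "cmod a < 1")
    case True
    have "1 - cnj a * z = z * cnj (z - a)"
      using complex_mod_mult_cnj that complex_norm_square[of z] by (simp add: algebra_simps)
    with True that show ?thesis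
      by (simp only: fac_def if_True norm_mult complex_mod_cnj)
  qed (simp add: fac_def)
  have "cmod (\<Prod>a\<in>#A. fac a z) = cmod (\<Prod>a\<in>#A. z - a)" if "cmod z = 1" for A z
    by (induction A) (simp_all add: norm_mult fac_circle that)
  moreover have "poly p z = lead_coeff p * (\<Prod>a\<in>#proots p. z - a)" for z
  proof -
    have "poly (\<Prod>a\<in>#A. [:- a, 1:]) z = (\<Prod>a\<in>#A. z - a)" for A
      by (induction A) (simp_all add: algebra_simps)
    then show ?thesis
      by (subst complex_poly_decompose_multiset[of p, symmetric]) simp
  qed
  ultimately have Q_circle: "cmod (Q z) = cmod (poly p z)" if "cmod z = 1" for z
    using that by (simp add: Q_def norm_mult)
  have "fac a holomorphic_on UNIV" for a
    by (cases "cmod a < 1") (auto simp: fac_def[abs_def] intro!: holomorphic_intros)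
  then have "(\<lambda>z. \<Prod>a\<in>#A. fac a z) holomorphic_on UNIV" for A
    by (induction A) (auto intro!: holomorphic_intros)
  then have hol: "Q holomorphic_on UNIV"
    unfolding Q_def by (intro holomorphic_intros)
  have "cmod (Q 0) \<le> M"
  proof (rule maximum_modulus_frontier[of Q "cball 0 1"])
    show "Q holomorphic_on interior (cball 0 1)"
      by (rule holomorphic_on_subset[OF hol]) simp
    show "continuous_on (closure (cball 0 1)) Q"
      by (rule holomorphic_on_imp_continuous_on, rule holomorphic_on_subset[OF hol]) simp
  qed (auto simp: Q_circle M)
  moreover have "cmod (\<Prod>a\<in>#A. fac a 0) = (\<Prod>a\<in>#A. max 1 (cmod a))" for A
    by (induction A) (auto simp: norm_mult fac_def max_def)
  ultimately show ?thesis
    by (simp add: Q_def norm_mult)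
qed

lemma power_card_le_prod_mset:
  fixes w :: "'a \<Rightarrow> real"
  assumes "\<And>a. a \<in># A \<Longrightarrow> 1 \<le> w a" "\<And>a. a \<in># A \<Longrightarrow> P a \<Longrightarrow> c \<le> w a" "0 \<le> c"
  shows "c ^ size (filter_mset P A) \<le> (\<Prod>a\<in>#A. w a)"
  using assms(1,2)
proof (induction A)
  case (add x A)
  have IH: "c ^ size (filter_mset P A) \<le> (\<Prod>a\<in>#A. w a)"
    using add by simp
  have "1 \<le> w x" "P x \<Longrightarrow> c \<le> w x" using add.prems by auto
  moreover have "0 \<le> c ^ size (filter_mset P A)" using assms(3) by simp
  ultimately show ?case
    using IH mult_mono[of c "w x" "c ^ size (filter_mset P A)" "\<Prod>a\<in>#A. w a"]
      mult_mono[of 1 "w x" "c ^ size (filter_mset P A)" "\<Prod>a\<in>#A. w a"] by auto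
qed simp

text \<open>
Over all zeros \<open>a\<close>, the weights \<open>(max 1 |a|)\<^sup>2 / |a|\<close> multiply up to the square of the Mahler
measure divided by the moduli of the leading and the constant coefficient. Such a weight is \<open>|a|\<close> outside the disc and \<open>1 / |a|\<close> inside, hence at least \<open>1\<close> everywhere and at
least \<open>1 + \<epsilon>\<close> at the zeros that are counted.
\<close>
lemma off_circle_roots_count:
  fixes p :: "complex poly"
  assumes M: "\<And>z. cmod z = 1 \<Longrightarrow> cmod (poly p z) \<le> M"
    and p0: "coeff p 0 = 1" and lc: "1 \<le> cmod (lead_coeff p)" and \<epsilon>: "0 < \<epsilon>"
  shows "(1 + \<epsilon>) ^ size {#a \<in># proots p. \<not> (1 - \<epsilon> < cmod a \<and> cmod a < 1 + \<epsilon>)#} \<le> M\<^sup>2"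
proof -
  define w :: "complex \<Rightarrow> real" where "w = (\<lambda>a. max 1 (cmod a) ^ 2 / cmod a)"
  define L where "L = cmod (lead_coeff p)"
  define X where "X = (\<Prod>a\<in>#proots p. max 1 (cmod a))"
  have nz: "a \<noteq> 0" if "a \<in># proots p" for a
    by (rule root_nonzero[OF _ that]) (simp add: p0)
  have w1: "1 \<le> w a" if "a \<noteq> 0" for a
    using that by (auto simp: w_def max_def field_simps power2_eq_square)
  \<comment> \<open>Inside the disc this uses \<open>(1 + \<epsilon>) (1 - \<epsilon>) \<le> 1\<close>.\<close>
  have w2: "1 + \<epsilon> \<le> w a" if "a \<noteq> 0" "\<not> (1 - \<epsilon> < cmod a \<and> cmod a < 1 + \<epsilon>)" for a
  proof (cases "cmod a \<le> 1")
    case True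
    with that \<epsilon> have "cmod a \<le> 1 - \<epsilon>" by auto
    then have "(1 + \<epsilon>) * cmod a \<le> (1 + \<epsilon>) * (1 - \<epsilon>)"
      using \<epsilon> by (intro mult_left_mono) auto
    also have "\<dots> \<le> 1" by (simp add: algebra_simps)
    finally show ?thesis using that True by (simp add: w_def max_def field_simps)
  next
    case False
    with that \<epsilon> show ?thesis by (auto simp: w_def max_def power2_eq_square)
  qed
  have "cmod (coeff p 0) = L * cmod (\<Prod>a\<in>#proots p. - a)"
    by (subst coeff_0_eq_prod_roots) (simp add: norm_mult L_def)
  moreover have "cmod (\<Prod>a\<in>#A. - a) = (\<Prod>a\<in>#A. cmod a)" for A
    by (induction A) (simp_all add: norm_mult)
  ultimately have prod: "L * (\<Prod>a\<in>#proots p. cmod a) = 1"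
    by (simp add: p0)
  have LX: "L * X \<le> M"
    unfolding L_def X_def by (rule mahler_measure_le_max_on_circle[OF M])
  have L1: "1 \<le> L" using lc by (simp add: L_def)
  \<comment> \<open>The product of all zeros has modulus \<open>1 / L\<close>, as the constant coefficient is \<open>1\<close>.\<close>
  have prod': "(\<Prod>a\<in>#proots p. cmod a) = 1 / L"
    using prod L1 by (simp add: eq_divide_eq mult.commute)
  have X0: "0 \<le> X"
  proof -
    have "0 \<le> (\<Prod>a\<in>#A. max 1 (cmod a))" for A
      by (induction A) auto
    then show ?thesis by (simp add: X_def)
  qed
  have "(1 + \<epsilon>) ^ size {#a \<in># proots p. \<not> (1 - \<epsilon> < cmod a \<and> cmod a < 1 + \<epsilon>)#}
          \<le> (\<Prod>a\<in>#proots p. w a)"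
    using w1 w2 nz \<epsilon> by (intro power_card_le_prod_mset) auto
  also have "(\<Prod>a\<in>#A. w a) = (\<Prod>a\<in>#A. max 1 (cmod a)) ^ 2 / (\<Prod>a\<in>#A. cmod a)" for A
    by (induction A) (simp_all add: w_def power_mult_distrib)
  also have "(\<Prod>a\<in>#proots p. max 1 (cmod a)) ^ 2 / (\<Prod>a\<in>#proots p. cmod a) = L * X\<^sup>2"
    using prod' unfolding X_def by simp
  also have "\<dots> \<le> (L * X)\<^sup>2"
    using L1 self_le_power[of L 2] by (simp add: power_mult_distrib mult_right_mono)
  also have "\<dots> \<le> M\<^sup>2"
    using LX L1 X0 by (intro power_mono) auto
  finally show ?thesis .
qed

section \<open>Power sums of the inverse zeros\<close>

text \<open>
Newton's identities are the comparison of coefficients in \<open>p' = - p * (\<Sum> s\<^sub>k\<^sub>+\<^sub>1 X\<^sup>k)\<close>, where \<open>s\<^sub>k\<close> is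
the sum of the \<open>k\<close>-th powers of the inverse zeros. This is the logarithmic derivative of
\<open>p = \<Prod> (1 - X / a)\<close>, which is additive over the factors and a geometric series on each of them.
\<close>
lemma newton_identity_inverse_roots:
  fixes p :: "complex poly"
  assumes p0: "coeff p 0 = 1"
  shows "of_nat (Suc k) * coeff p (Suc k) =
    - (\<Sum>i=0..k. coeff p i * (\<Sum>a\<in>#proots p. inverse a ^ Suc (k - i)))"
proof -
  define S where "S = (\<lambda>A :: complex multiset. Abs_fps (\<lambda>k. \<Sum>a\<in>#A. inverse a ^ Suc k))"
  have nz: "a \<noteq> 0" if "a \<in># proots p" for a
    by (rule root_nonzero[OF _ that]) (simp add: p0)
  have "[:- a, 1:] = smult (- a) [:1, - inverse a:]" if "a \<noteq> 0" for a :: complex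
    using that by simp
  then have "(\<Prod>a\<in>#A. [:- a, 1:]) = smult (\<Prod>a\<in>#A. - a) (\<Prod>a\<in>#A. [:1, - inverse a:])"
    if "\<forall>a\<in>#A. a \<noteq> 0" for A :: "complex multiset"
    using that
  proof (induction A)
    case (add x A)
    then show ?case by (simp del: smult_pCons mult_pCons_left add: mult.commute)
  qed simp
  then have "p = smult (lead_coeff p * (\<Prod>a\<in>#proots p. - a)) (\<Prod>a\<in>#proots p. [:1, - inverse a:])"
    by (subst complex_poly_decompose_multiset[of p, symmetric]) (simp add: nz)
  then have p: "p = (\<Prod>a\<in>#proots p. [:1, - inverse a:])"
    unfolding coeff_0_eq_prod_roots[symmetric] p0 by simp
  have geom: "fps_deriv (fps_of_poly [:1, - c:]) =
      - fps_of_poly [:1, - c:] * Abs_fps (\<lambda>k. c ^ Suc k)" for c :: complex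
  proof (rule fps_ext)
    fix n
    show "fps_nth (fps_deriv (fps_of_poly [:1, - c:])) n =
        fps_nth (- fps_of_poly [:1, - c:] * Abs_fps (\<lambda>k. c ^ Suc k)) n"
      by (cases n) (simp_all add: fps_of_poly_linear' algebra_simps coeff_pCons fps_of_poly_pderiv[symmetric] pderiv_pCons split: nat.splits)
  qed
  have "fps_deriv (fps_of_poly (\<Prod>a\<in>#A. [:1, - inverse a:])) =
      - fps_of_poly (\<Prod>a\<in>#A. [:1, - inverse a:]) * S A" for A
  proof (induction A)
    case empty
    then show ?case by (simp add: S_def fps_eq_iff)
  next
    case (add x A)
    have S: "S (add_mset x A) = Abs_fps (\<lambda>k. inverse x ^ Suc k) + S A"
      by (simp add: S_def fps_eq_iff)
    show ?case
      unfolding S image_mset_add_mset prod_mset.add_mset fps_of_poly_mult fps_deriv_mult add geom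
      by (simp add: algebra_simps)
  qed
  from this[of "proots p"] have "fps_deriv (fps_of_poly p) = - (fps_of_poly p * S (proots p))"
    unfolding p[symmetric] by simp
  then have "fps_nth (fps_deriv (fps_of_poly p)) k = fps_nth (- (fps_of_poly p * S (proots p))) k"
    by (rule arg_cong)
  then show ?thesis
    by (simp add: fps_mult_nth S_def)
qed

text \<open>
Newton's identities express the power sum of order \<open>k + 1\<close> by the first \<open>k + 1\<close> nonconstant coefficients
and by the power sums of lower order, so bounds on the individual coefficients that are uniform in \<open>m\<close>
propagate by induction on \<open>k\<close>, no matter how the degrees grow.
\<close>
lemma inverse_power_sums_bounded:
  fixes p :: "nat \<Rightarrow> complex poly"
  assumes p0: "\<And>m. coeff (p m) 0 = 1" and b: "\<And>m i. cmod (coeff (p m) i) \<le> b i"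
  shows "\<exists>K. \<forall>m. cmod (\<Sum>a\<in>#proots (p m). inverse a ^ Suc k) \<le> K"
proof (induction k rule: less_induct)
  case (less k)
  define s where "s = (\<lambda>m k. \<Sum>a\<in>#proots (p m). inverse a ^ Suc k)"
  from less have "\<forall>j. \<exists>K. j < k \<longrightarrow> (\<forall>m. cmod (s m j) \<le> K)"
    unfolding s_def by blast
  then obtain K where K: "\<And>j m. j < k \<Longrightarrow> cmod (s m j) \<le> K j"
    by metis
  have "cmod (s m k) \<le> real (Suc k) * b (Suc k) + (\<Sum>i=1..k. b i * K (k - i))" for m
  proof -
    have "of_nat (Suc k) * coeff (p m) (Suc k) = - (\<Sum>i=0..k. coeff (p m) i * s m (k - i))"
      unfolding s_def by (rule newton_identity_inverse_roots[OF p0])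
    also have "(\<Sum>i=0..k. coeff (p m) i * s m (k - i)) =
        s m k + (\<Sum>i=1..k. coeff (p m) i * s m (k - i))"
      by (simp add: sum.atLeast_Suc_atMost p0)
    finally have "s m k = - (of_nat (Suc k) * coeff (p m) (Suc k)
        + (\<Sum>i=1..k. coeff (p m) i * s m (k - i)))"
      by (simp add: algebra_simps)
    then have "cmod (s m k) \<le> cmod (of_nat (Suc k) * coeff (p m) (Suc k))
        + (\<Sum>i=1..k. cmod (coeff (p m) i * s m (k - i)))"
      unfolding norm_minus_cancel
      by (simp only: norm_minus_cancel) (intro norm_triangle_mono order_refl norm_sum)
    also have "\<dots> \<le> real (Suc k) * b (Suc k) + (\<Sum>i=1..k. b i * K (k - i))"
      unfolding norm_mult norm_of_nat
      using b norm_ge_zero order_trans[OF norm_ge_zero b]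
      by (intro add_mono mult_left_mono sum_mono mult_mono K) auto
    finally show ?thesis .
  qed
  then show ?case unfolding s_def by blast
qed

text \<open>
Where \<open>|z| < 1 / (2 C)\<close> the nonconstant terms are dominated by a geometric series of ratio less
than \<open>1/2\<close>, so they cannot cancel the constant term.
\<close>
lemma root_norm_lower_bound:
  fixes p :: "complex poly"
  assumes p0: "coeff p 0 = 1" and b: "\<And>i. cmod (coeff p i) \<le> C ^ i" and C: "0 < C"
    and z: "poly p z = 0"
  shows "1 / (2 * C) \<le> cmod z"
proof (rule ccontr)
  define r where "r = C * cmod z"
  assume "\<not> ?thesis"
  then have r: "0 \<le> r" "r < 1 / 2" using C by (auto simp: r_def field_simps)
  have "poly p z = (\<Sum>i\<le>degree p. coeff p i * z ^ i)" by (rule poly_altdef)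
  also have "\<dots> = 1 + (\<Sum>i<degree p. coeff p (Suc i) * z ^ Suc i)"
    by (simp add: lessThan_Suc_atMost[symmetric] sum.lessThan_Suc_shift p0 del: sum.lessThan_Suc power_Suc)
  finally have "(\<Sum>i<degree p. coeff p (Suc i) * z ^ Suc i) = - 1"
    using z by (simp add: add_eq_0_iff)
  then have "1 = cmod (\<Sum>i<degree p. coeff p (Suc i) * z ^ Suc i)" by simp
  also have "\<dots> \<le> (\<Sum>i<degree p. r ^ Suc i)"
  proof (rule sum_norm_le)
    fix i
    have "cmod (coeff p (Suc i)) * cmod z ^ Suc i \<le> C ^ Suc i * cmod z ^ Suc i"
      by (intro mult_right_mono b) simp
    then show "cmod (coeff p (Suc i) * z ^ Suc i) \<le> r ^ Suc i"
      by (simp only: norm_mult norm_power r_def power_mult_distrib)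
  qed
  also have "\<dots> = r * ((1 - r ^ degree p) / (1 - r))"
    using r by (simp add: sum_distrib_left[symmetric] sum_gp_strict)
  also have "\<dots> \<le> r * (1 / (1 - r))"
    using r by (intro mult_left_mono divide_right_mono) auto
  also have "\<dots> < 1" using r by (simp add: field_simps)
  finally show False by simp
qed

section \<open>The uniform distribution on the circle\<close>

lemma sets_circle_haar [simp, measurable_cong]: "sets circle_haar = sets borel"
  by (simp add: circle_haar_def)

lemma cis_measurable [measurable]: "cis \<in> borel_measurable borel"
  by (intro borel_measurable_continuous_onI continuous_intros)

lemma integral_circle_haar:
  fixes f :: "complex \<Rightarrow> 'b :: {banach, second_countable_topology}"
  assumes f: "continuous_on UNIV f"
  shows "(\<integral>z. f z \<partial>circle_haar) = (1 / (2 * pi)) *\<^sub>R (\<integral>t\<in>{0..2*pi}. f (cis t) \<partial>lborel)"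
proof -
  have [measurable]: "f \<in> borel_measurable borel"
    by (intro borel_measurable_continuous_onI f)
  have "(\<integral>z. f z \<partial>circle_haar) = (\<integral>t. f (cis t) \<partial>uniform_measure lborel {0..<2 * pi})"
    unfolding circle_haar_def by (rule integral_distr) measurable
  also have "\<dots> = (\<integral>t. (indicator {0..<2*pi} t / (2 * pi)) *\<^sub>R f (cis t) \<partial>lborel)"
    unfolding uniform_measure_def
  proof (subst integral_density[symmetric])
    have "indicator {0..<2 * pi} x / emeasure lborel {0..<2 * pi} =
      ennreal (indicator {0..<2 * pi} x / (2 * pi))" for x
      by (auto simp: indicator_def divide_ennreal[symmetric] ennreal_1[symmetric] simp del: ennreal_1)
    then show "(\<integral>t. f (cis t) \<partial>density lborel (\<lambda>x. indicator {0..<2 * pi} x / emeasure lborel {0..<2 * pi})) =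
      (\<integral>t. f (cis t) \<partial>density lborel (\<lambda>x. ennreal (indicator {0..<2 * pi} x / (2 * pi))))"
      by simp
  qed auto
  also have "\<dots> = (\<integral>t. (1 / (2 * pi)) *\<^sub>R (indicator {0..2*pi} t *\<^sub>R f (cis t)) \<partial>lborel)"
  proof (rule integral_cong_AE)
    show "AE t in lborel. (indicator {0..<2*pi} t / (2 * pi)) *\<^sub>R f (cis t) =
      (1 / (2 * pi)) *\<^sub>R (indicator {0..2*pi} t *\<^sub>R f (cis t))"
      using AE_lborel_singleton[of "2 * pi"] by eventually_elim (auto simp: indicator_def)
  qed measurable
  finally show ?thesis
    unfolding set_lebesgue_integral_def integral_scaleR_right .
qed

lemma integral_circle_haar_power:
  assumes "1 \<le> k"
  shows "(\<integral>z. z ^ k \<partial>circle_haar) = 0"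
proof -
  \<comment> \<open>An antiderivative of \<open>cis t ^ k\<close> with period \<open>2 \<pi>\<close>.\<close>
  define F where "F = (\<lambda>t. cis (real k * t) / (\<i> * of_nat k))"
  have "(F has_vector_derivative cis t ^ k) (at t within {0..2*pi})" for t
  proof -
    have "((\<lambda>t. exp (\<i> * of_nat k * t) / (\<i> * of_nat k)) has_field_derivative
      exp (\<i> * of_nat k * t)) (at t)" for t :: complex
      using assms by (auto intro!: derivative_eq_intros)
    then have "((\<lambda>t. exp (\<i> * of_nat k * of_real t) / (\<i> * of_nat k)) has_vector_derivative
      exp (\<i> * of_nat k * of_real t)) (at t within {0..2*pi})"
      using has_vector_derivative_real_field has_vector_derivative_at_within by blast
    then show ?thesis
      unfolding F_def Complex.DeMoivre unfolding cis_conv_exp by (simp add: mult_ac)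
  qed
  then have "(\<integral>t\<in>{0..2*pi}. cis t ^ k \<partial>lborel) = F (2 * pi) - F 0"
    unfolding set_lebesgue_integral_def
    by (intro integral_FTC_atLeastAtMost) (auto intro!: continuous_intros)
  also have "F (2 * pi) = F 0"
    by (simp add: F_def cis_multiple_2pi mult.commute[of _ "2 * pi"] Ints_of_nat)
  finally have "(\<integral>t\<in>{0..2*pi}. cis t ^ k \<partial>lborel) = 0" by simp
  then show ?thesis
    by (subst integral_circle_haar) (auto intro!: continuous_intros)
qed

lemma AE_circle_haar_unit: "AE z in circle_haar. cmod z = 1"
  unfolding circle_haar_def
  by (subst AE_distr_iff) auto

lemma borel_measurable_circle_haar:
  fixes f :: "complex \<Rightarrow> 'b :: topological_space"
  shows "continuous_on UNIV f \<Longrightarrow> f \<in> borel_measurable circle_haar"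
  by (simp add: measurable_cong_sets[OF sets_circle_haar refl] borel_measurable_continuous_onI)

lemma integrable_circle_haar:
  fixes f :: "complex \<Rightarrow> 'b :: {banach, second_countable_topology}"
  assumes "continuous_on UNIV f"
  shows "integrable circle_haar f"
proof -
  interpret prob_space circle_haar by (rule prob_space_circle_haar)
  have "continuous_on (sphere 0 1) f"
    by (rule continuous_on_subset[OF assms]) simp
  then have "bounded (f ` sphere 0 1)"
    by (intro compact_imp_bounded compact_continuous_image) auto
  then obtain B where B: "\<forall>y\<in>f ` sphere 0 1. norm y \<le> B"
    unfolding bounded_iff by blast
  have "AE z in circle_haar. norm (f z) \<le> B"
    using AE_circle_haar_unit by eventually_elim (use B in auto)
  then show ?thesis
    using assms by (intro integrable_const_bound) (auto intro!: borel_measurable_circle_haar)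
qed

text \<open>
The preimage of the arc in \<open>[0, 2 \<pi>)\<close> consists of at most two intervals: after moving \<open>a\<close> into
\<open>[0, 2 \<pi>)\<close> by a multiple of \<open>2 \<pi>\<close>, an arc shorter than the circle can pass the angle \<open>2 \<pi>\<close> only
once.
\<close>
lemma measure_circle_haar_arc:
  assumes "a \<le> b"
  shows "measure circle_haar (cis ` {a..b}) \<le> (b - a) / (2 * pi)"
proof (cases "b - a < 2 * pi")
  case False
  interpret prob_space circle_haar by (rule prob_space_circle_haar)
  have "1 \<le> (b - a) / (2 * pi)" using False by (simp add: field_simps)
  then show ?thesis using prob_le_1 order_trans by blast
next
  case True
  define n where "n = \<lfloor>a / (2 * pi)\<rfloor>"
  define c where "c = a - 2 * pi * n"
  define d where "d = b - 2 * pi * n"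
  have c: "0 \<le> c" "c < 2 * pi"
    using floor_correct[of "a / (2 * pi)"] unfolding c_def n_def[symmetric] by (auto simp: field_simps)
  have cd: "c \<le> d" "d - c < 2 * pi" "d - c = b - a" using assms True by (auto simp: c_def d_def)
  have closed: "cis ` {a..b} \<in> sets borel"
    by (intro borel_compact compact_continuous_image continuous_intros) auto
  have sub: "{0..<2*pi} \<inter> cis -` (cis ` {a..b}) \<subseteq> {c..min d (2*pi)} \<union> {0..max 0 (d - 2*pi)}"
  proof
    fix t assume "t \<in> {0..<2*pi} \<inter> cis -` (cis ` {a..b})"
    then obtain s where t: "0 \<le> t" "t < 2*pi" and s: "a \<le> s" "s \<le> b" and "cis t = cis s"
      by auto
    then obtain k :: int where k: "t = s + 2 * pi * k"
    proof -
      obtain j :: int where "\<i> * complex_of_real t = \<i> * of_real s + of_int (2 * j) * pi * \<i>"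
        using \<open>cis t = cis s\<close> unfolding cis_conv_exp exp_eq by blast
      from arg_cong[OF this, of Im] show thesis by (intro that[of j]) simp
    qed
    define s' where "s' = s - 2 * pi * n"
    have s': "c \<le> s'" "s' \<le> d" using s by (auto simp: s'_def c_def d_def)
    have "t = s' + 2 * pi * of_int (k + n)" by (simp add: s'_def k algebra_simps)
    show "t \<in> {c..min d (2*pi)} \<union> {0..max 0 (d - 2*pi)}"
    proof -
      define j where "j = k + n"
      have tj: "t = s' + 2 * pi * of_int j" using \<open>t = s' + _\<close> by (simp add: j_def)
      have "\<not> 1 \<le> j"
      proof
        assume "1 \<le> j"
        then have "2 * pi * 1 \<le> 2 * pi * real_of_int j" by (intro mult_left_mono) auto
        with tj t(2) s' c show False by linarith
      qed
      moreover have "\<not> j \<le> - 2"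
      proof
        assume "j \<le> - 2"
        then have "2 * pi * real_of_int j \<le> 2 * pi * (- 2)" by (intro mult_left_mono) auto
        with tj t(1) s' c cd show False by linarith
      qed
      \<comment> \<open>Since \<open>0 \<le> s' < 4 \<pi>\<close>, a shift into \<open>[0, 2 \<pi>)\<close> is by \<open>0\<close> or by \<open>- 2 \<pi>\<close>.\<close>
      ultimately consider "j = 0" | "j = - 1" by linarith
      then show ?thesis
      proof cases
        case 1
        with tj s' t show ?thesis by auto
      next
        case 2
        with tj s' t have "t \<le> d - 2 * pi" by simp
        with t show ?thesis by auto
      qed
    qed
  qed
  have "measure circle_haar (cis ` {a..b}) = measure lborel ({0..<2*pi} \<inter> cis -` (cis ` {a..b})) / (2 * pi)"
    unfolding circle_haar_def using closed
    by (subst measure_distr) (auto simp: measurable_sets_borel[OF cis_measurable])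
  also have "\<dots> \<le> (b - a) / (2 * pi)"
  proof (rule divide_right_mono)
    have [simp]: "{x..y} \<in> fmeasurable lborel" for x y :: real
      by (simp add: fmeasurable_def emeasure_lborel_Icc_eq)
    have "measure lborel ({0..<2*pi} \<inter> cis -` (cis ` {a..b}))
        \<le> measure lborel ({c..min d (2*pi)} \<union> {0..max 0 (d - 2*pi)})"
      using closed
      by (intro measure_mono_fmeasurable sub fmeasurable.Un sets.Int) (auto simp: measurable_sets_borel[OF cis_measurable])
    also have "\<dots> \<le> measure lborel {c..min d (2*pi)} + measure lborel {0..max 0 (d - 2*pi)}"
      by (rule measure_Un_le) auto
    also have "\<dots> = b - a" using c cd by (auto simp: min_def max_def)
    finally show "measure lborel ({0..<2*pi} \<inter> cis -` (cis ` {a..b})) \<le> b - a" .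
  qed simp
  finally show ?thesis .
qed

section \<open>The criterion of Weyl\<close>

text \<open>
On the unit circle the conjugate of \<open>u\<close> is its inverse, so a real polynomial in the two coordinates is a
Laurent polynomial in \<open>u\<close>. Writing it as a polynomial times a power of \<open>cnj u\<close> makes this class of
functions visibly closed under sums and products.
\<close>
lemma real_polynomial_on_circle:
  fixes g :: "complex \<Rightarrow> real"
  assumes "real_polynomial_function g"
  shows "\<exists>n p. \<forall>u. cmod u = 1 \<longrightarrow> of_real (g u) = poly p u * cnj u ^ n"
  using assms
proof (induction g rule: real_polynomial_function.induct)
  case (linear g)
  then interpret bounded_linear g .
  \<comment> \<open>The coefficients come from \<open>Re u = (u + cnj u) / 2\<close> and \<open>Im u = (u - cnj u) / (2 \<i>)\<close>.\<close>
  have "of_real (g u) = poly [: (g 1 + \<i> * g \<i>) / 2, 0, (g 1 - \<i> * g \<i>) / 2 :] u * cnj u ^ 1"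
    if u: "cmod u = 1" for u
  proof -
    have uu: "u * cnj u = 1" using u complex_norm_square[of u] by simp
    have "u = Re u *\<^sub>R 1 + Im u *\<^sub>R \<i>" by (simp add: complex_eq_iff)
    then have "g u = Re u * g 1 + Im u * g \<i>" by (metis add scaleR real_scaleR_def)
    moreover have "complex_of_real (Re u) = (u + cnj u) / 2" "complex_of_real (Im u) = (u - cnj u) / (2 * \<i>)"
      by (simp_all add: complex_eq_iff)
    ultimately have "complex_of_real (g u) = (u + cnj u) / 2 * g 1 + (u - cnj u) / (2 * \<i>) * g \<i>"
      by (simp only: of_real_add of_real_mult)
    also have "\<dots> = (u + cnj u) / 2 * g 1 - \<i> * (u - cnj u) / 2 * g \<i>"
      by (simp add: field_simps)
    also have "\<dots> = ((g 1 + \<i> * g \<i>) / 2) * cnj u + (g 1 - \<i> * g \<i>) / 2 * u * (u * cnj u)"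
      unfolding uu by (simp add: field_simps)
    finally show ?thesis by (simp add: algebra_simps)
  qed
  then show ?case by blast
next
  case (const c)
  show ?case by (rule exI[of _ 0], rule exI[of _ "[: of_real c :]"]) simp
next
  case (add f g)
  then obtain n p m q where
    p: "\<And>u. cmod u = 1 \<Longrightarrow> of_real (f u) = poly p u * cnj u ^ n" and
    q: "\<And>u. cmod u = 1 \<Longrightarrow> of_real (g u) = poly q u * cnj u ^ m" by blast
  have "of_real (f u + g u) = poly (p * monom 1 m + q * monom 1 n) u * cnj u ^ (n + m)"
    if u: "cmod u = 1" for u
  proof -
    have uu: "u * cnj u = 1" using u complex_norm_square[of u] by simp
    have "poly (p * monom 1 m + q * monom 1 n) u * cnj u ^ (n + m) =
      poly p u * cnj u ^ n * (u * cnj u) ^ m + poly q u * cnj u ^ m * (u * cnj u) ^ n"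
      by (simp add: poly_monom power_add power_mult_distrib algebra_simps)
    then show ?thesis using p[OF u] q[OF u] by (simp add: uu)
  qed
  then show ?case by blast
next
  case (mult f g)
  then obtain n p m q where
    p: "\<And>u. cmod u = 1 \<Longrightarrow> of_real (f u) = poly p u * cnj u ^ n" and
    q: "\<And>u. cmod u = 1 \<Longrightarrow> of_real (g u) = poly q u * cnj u ^ m" by blast
  have "of_real (f u * g u) = poly (p * q) u * cnj u ^ (n + m)" if u: "cmod u = 1" for u
    using p[OF u] q[OF u] by (simp add: power_add)
  then show ?case by blast
qed

text \<open>
By linearity only the functions \<open>u\<^sup>i * cnj u\<^sup>n\<close> matter. On the circle these are powers of \<open>u\<close>, conjugates
of such powers, or \<open>1\<close>, which is why moments of positive order suffice as a hypothesis.
\<close>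
lemma avg_real_polynomial_tendsto:
  fixes A :: "nat \<Rightarrow> complex multiset"
  assumes unit: "\<And>m a. a \<in># A m \<Longrightarrow> cmod a = 1"
    and ne: "eventually (\<lambda>m. A m \<noteq> {#}) sequentially"
    and mom: "\<And>k. 1 \<le> k \<Longrightarrow> (\<lambda>m. avg (\<lambda>u. u ^ k) (A m)) \<longlonglongrightarrow> 0"
    and g: "real_polynomial_function g"
  shows "(\<lambda>m. avg g (A m)) \<longlonglongrightarrow> (\<integral>z. g z \<partial>circle_haar)"
proof -
  interpret prob_space circle_haar by (rule prob_space_circle_haar)
  have conv: "(\<lambda>m. avg (\<lambda>u. u ^ i * cnj u ^ n) (A m)) \<longlonglongrightarrow> (\<integral>z. z ^ i * cnj z ^ n \<partial>circle_haar)"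
    for i n
  proof -
    define h :: "complex \<Rightarrow> complex" where
      "h = (if n < i then (\<lambda>u. u ^ (i - n)) else if i < n then (\<lambda>u. cnj (u ^ (n - i))) else (\<lambda>_. 1))"
    have h: "u ^ i * cnj u ^ n = h u" if "cmod u = 1" for u
    proof -
      have uu: "u * cnj u = 1" using that complex_norm_square[of u] by simp
      have "u ^ (n + d) * cnj u ^ n = u ^ d" "u ^ i * cnj u ^ (i + d) = cnj (u ^ d)" for d
        using arg_cong[OF uu, of "\<lambda>x. x ^ n"] arg_cong[OF uu, of "\<lambda>x. x ^ i"]
        by (simp_all add: power_add power_mult_distrib mult_ac)
      from this(1)[of "i - n"] this(2)[of "n - i"] show ?thesis
        by (auto simp: h_def not_less le_antisym)
    qed
    have "(\<lambda>m. avg h (A m)) \<longlonglongrightarrow> (\<integral>z. h z \<partial>circle_haar)"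
    proof (cases i n rule: linorder_cases)
      case less
      have "(\<lambda>m. cnj (avg (\<lambda>u. u ^ (n - i)) (A m))) \<longlonglongrightarrow> cnj 0"
        using less by (intro tendsto_cnj mom) auto
      moreover have "(\<integral>z. cnj (z ^ (n - i)) \<partial>circle_haar) = cnj (\<integral>z. z ^ (n - i) \<partial>circle_haar)"
        by (rule Bochner_Integration.integral_cnj)
      ultimately show ?thesis
        using less by (simp add: h_def avg_cnj[symmetric] integral_circle_haar_power del: complex_cnj_power)
    next
      case equal
      have "eventually (\<lambda>m. avg h (A m) = 1) sequentially"
        using ne by eventually_elim (simp add: equal h_def avg_const)
      then show ?thesis
        using equal prob_space by (simp add: h_def tendsto_eventually)
    next
      case greater
      then show ?thesis using mom[of "i - n"] by (simp add: h_def integral_circle_haar_power)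
    qed
    moreover have "avg (\<lambda>u. u ^ i * cnj u ^ n) (A m) = avg h (A m)" for m
      unfolding avg_def by (intro arg_cong2[of _ _ _ _ "(/)"] arg_cong[of _ _ sum_mset] image_mset_cong h unit) auto
    moreover have "(\<integral>z. z ^ i * cnj z ^ n \<partial>circle_haar) = (\<integral>z. h z \<partial>circle_haar)"
    proof (rule integral_cong_AE)
      show "AE z in circle_haar. z ^ i * cnj z ^ n = h z"
        using AE_circle_haar_unit by eventually_elim (rule h)
    qed (auto intro!: borel_measurable_circle_haar continuous_intros simp: h_def)
    ultimately show ?thesis by simp
  qed
  obtain n p where p: "\<And>u. cmod u = 1 \<Longrightarrow> of_real (g u) = poly p u * cnj u ^ n"
    using real_polynomial_on_circle[OF g] by blast
  have p': "of_real (g u) = (\<Sum>i\<le>degree p. coeff p i * (u ^ i * cnj u ^ n))" if "cmod u = 1" for u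
    using p[OF that] by (simp add: poly_altdef sum_distrib_right mult.assoc)
  have "of_real (avg g (A m)) = (\<Sum>i\<le>degree p. coeff p i * avg (\<lambda>u. u ^ i * cnj u ^ n) (A m))" for m
    unfolding avg_of_real[symmetric] avg_cmult[symmetric] avg_sum[symmetric] unfolding avg_def
    by (intro arg_cong2[of _ _ _ _ "(/)"] arg_cong[of _ _ sum_mset] image_mset_cong p' unit) auto
  moreover have "of_real (\<integral>z. g z \<partial>circle_haar) =
    (\<Sum>i\<le>degree p. coeff p i * (\<integral>z. z ^ i * cnj z ^ n \<partial>circle_haar))"
  proof -
    have int: "integrable circle_haar (\<lambda>z. coeff p i * (z ^ i * cnj z ^ n))" for i
      by (intro integrable_circle_haar continuous_intros)
    have contg: "continuous_on UNIV g"
      using g continuous_on_polymonial_function real_polynomial_function_eq by blast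
    have "of_real (\<integral>z. g z \<partial>circle_haar) = (\<integral>z. complex_of_real (g z) \<partial>circle_haar)"
      by simp
    also have "\<dots> = (\<integral>z. (\<Sum>i\<le>degree p. coeff p i * (z ^ i * cnj z ^ n)) \<partial>circle_haar)"
    proof (rule integral_cong_AE)
      show "AE z in circle_haar. complex_of_real (g z) = (\<Sum>i\<le>degree p. coeff p i * (z ^ i * cnj z ^ n))"
        using AE_circle_haar_unit by eventually_elim (rule p')
    qed (auto intro!: borel_measurable_circle_haar continuous_intros contg)
    also have "\<dots> = (\<Sum>i\<le>degree p. (\<integral>z. coeff p i * (z ^ i * cnj z ^ n) \<partial>circle_haar))"
      by (intro Bochner_Integration.integral_sum int)
    finally show ?thesis by simp
  qed
  moreover have "(\<lambda>m. \<Sum>i\<le>degree p. coeff p i * avg (\<lambda>u. u ^ i * cnj u ^ n) (A m)) \<longlonglongrightarrow>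
    (\<Sum>i\<le>degree p. coeff p i * (\<integral>z. z ^ i * cnj z ^ n \<partial>circle_haar))"
    by (intro tendsto_intros conv)
  ultimately have "(\<lambda>m. complex_of_real (avg g (A m))) \<longlonglongrightarrow> of_real (\<integral>z. g z \<partial>circle_haar)"
    by simp
  then show ?thesis by (simp only: tendsto_of_real_iff)
qed

text \<open>
Weyl's criterion: by the Stone-Weierstrass theorem a continuous function is uniformly close on the circle to
a real polynomial, and both averages and the integral are monotone.
\<close>
lemma weyl_criterion_circle:
  fixes A :: "nat \<Rightarrow> complex multiset" and f :: "complex \<Rightarrow> real"
  assumes unit: "\<And>m a. a \<in># A m \<Longrightarrow> cmod a = 1"
    and ne: "eventually (\<lambda>m. A m \<noteq> {#}) sequentially"
    and mom: "\<And>k. 1 \<le> k \<Longrightarrow> (\<lambda>m. avg (\<lambda>u. u ^ k) (A m)) \<longlonglongrightarrow> 0"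
    and f: "continuous_on UNIV f"
  shows "(\<lambda>m. avg f (A m)) \<longlonglongrightarrow> (\<integral>z. f z \<partial>circle_haar)"
proof (rule tendstoI)
  fix e :: real assume "0 < e"
  interpret prob_space circle_haar by (rule prob_space_circle_haar)
  obtain g where g: "real_polynomial_function g" "\<And>u. cmod u = 1 \<Longrightarrow> \<bar>f u - g u\<bar> < e / 3"
    using Stone_Weierstrass_real_polynomial_function[of "sphere 0 1" f "e / 3"] f \<open>0 < e\<close>
    by (auto intro: continuous_on_subset)
  have contg: "continuous_on UNIV g"
    using g continuous_on_polymonial_function real_polynomial_function_eq by blast
  have int: "integrable circle_haar f" "integrable circle_haar g"
    by (intro integrable_circle_haar f contg)+
  have I: "\<bar>(\<integral>z. f z \<partial>circle_haar) - (\<integral>z. g z \<partial>circle_haar)\<bar> \<le> e / 3"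
  proof -
    have "\<bar>\<integral>z. f z - g z \<partial>circle_haar\<bar> \<le> (\<integral>z. \<bar>f z - g z\<bar> \<partial>circle_haar)"
      by (rule integral_abs_bound)
    also have "\<dots> \<le> (\<integral>z. e / 3 \<partial>circle_haar)"
    proof (rule integral_mono_AE)
      show "AE z in circle_haar. \<bar>f z - g z\<bar> \<le> e / 3"
        using AE_circle_haar_unit by eventually_elim (use g(2) less_imp_le in blast)
    qed (use int in auto)
    finally show ?thesis using int prob_space by simp
  qed
  have "eventually (\<lambda>m. dist (avg g (A m)) (\<integral>z. g z \<partial>circle_haar) < e / 3) sequentially"
    using avg_real_polynomial_tendsto[OF unit ne mom g(1)] \<open>0 < e\<close> by (intro tendstoD) auto
  then show "eventually (\<lambda>m. dist (avg f (A m)) (\<integral>z. f z \<partial>circle_haar) < e) sequentially"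
    using ne
  proof eventually_elim
    case (elim m)
    have "\<bar>avg (\<lambda>u. f u - g u) (A m)\<bar> \<le> avg (\<lambda>u. e / 3) (A m)"
      using norm_avg_le[of "A m" "\<lambda>u. f u - g u" "\<lambda>u. e / 3"] g(2) unit by (auto simp: less_imp_le)
    then have "\<bar>avg f (A m) - avg g (A m)\<bar> \<le> e / 3"
      using elim by (simp add: avg_diff avg_const)
    then show ?case using I elim(1) by (simp only: dist_real_def abs_less_iff abs_le_iff) linarith
  qed
qed

section \<open>Equidistribution in arcs\<close>

text \<open>
This is the half of the portmanteau theorem that concerns closed sets. The functions
\<open>max 0 (1 - n * infdist z F)\<close> are continuous, lie above the indicator of \<open>F\<close>, and decrease to it.
\<close>
lemma avg_closed_less_eventually:
  fixes A :: "nat \<Rightarrow> complex multiset"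
  assumes lim: "\<And>f :: complex \<Rightarrow> real. continuous_on UNIV f \<Longrightarrow>
      (\<lambda>m. avg f (A m)) \<longlonglongrightarrow> (\<integral>z. f z \<partial>L)"
    and L: "prob_space L" "sets L = sets borel" and F: "closed F" "F \<noteq> {}" and e: "0 < e"
  shows "eventually (\<lambda>m. avg (\<lambda>u. of_bool (u \<in> F)) (A m) < measure L F + e) sequentially"
proof -
  interpret prob_space L by fact
  define h where "h = (\<lambda>(n::nat) z. max 0 (1 - real n * infdist z F))"
  have conth: "continuous_on UNIV (h n)" for n
    unfolding h_def by (intro continuous_intros)
  have [measurable]: "h n \<in> borel_measurable L" for n
    using borel_measurable_continuous_onI[OF conth[of n]] measurable_cong_sets[OF L(2) refl] by blast
  have Fm: "F \<in> sets L" using F L(2) by simp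
  have "(\<lambda>n. \<integral>z. h n z \<partial>L) \<longlonglongrightarrow> (\<integral>z. indicator F z \<partial>L)"
  proof (rule integral_dominated_convergence[where w = "\<lambda>_. 1"])
    have "(\<lambda>n. h n z) \<longlonglongrightarrow> indicator F z" for z
    proof (cases "z \<in> F")
      case True
      then show ?thesis by (simp add: h_def)
    next
      case False
      then have pos: "0 < infdist z F"
        using F in_closed_iff_infdist_zero[of F z] infdist_nonneg[of z F] by fastforce
      obtain N where N: "1 / infdist z F < real N" using reals_Archimedean2 by blast
      have "h n z = 0" if "N \<le> n" for n
      proof -
        have "1 < real N * infdist z F" using N pos by (simp add: field_simps)
        also have "\<dots> \<le> real n * infdist z F" using that pos by (intro mult_right_mono) auto
        finally show ?thesis by (simp add: h_def)
      qed
      then show ?thesis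
        using False by (auto intro!: tendsto_eventually eventually_sequentiallyI)
    qed
    then show "AE z in L. (\<lambda>n. h n z) \<longlonglongrightarrow> indicator F z" by simp
    show "AE z in L. norm (h n z) \<le> 1" for n by (simp add: h_def infdist_nonneg)
  qed (use Fm in auto)
  then have "(\<lambda>n. \<integral>z. h n z \<partial>L) \<longlonglongrightarrow> measure L F" using Fm by simp
  then have "eventually (\<lambda>n. (\<integral>z. h n z \<partial>L) < measure L F + e) sequentially"
    by (rule order_tendstoD) (use e in auto)
  then obtain n where n: "(\<integral>z. h n z \<partial>L) < measure L F + e"
    by (auto simp: eventually_sequentially)
  have "eventually (\<lambda>m. avg (h n) (A m) < measure L F + e) sequentially"
    by (rule order_tendstoD(2)[OF lim[OF conth] n])
  then show ?thesis
  proof eventually_elim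
    case (elim m)
    have "avg (\<lambda>u. of_bool (u \<in> F)) (A m) \<le> avg (h n) (A m)"
      by (rule avg_mono) (auto simp: h_def)
    with elim show ?case by simp
  qed
qed

text \<open>
A set between an open arc and the corresponding closed one is contained in the closed arc, and its
complement in the closed complementary arc. The upper bounds for these two closed arcs add up to \<open>1\<close>,
so together they pin down the proportion, whichever endpoints belong to the arc.
\<close>
lemma avg_arc_tendsto:
  fixes A :: "nat \<Rightarrow> complex multiset"
  assumes ne: "eventually (\<lambda>m. A m \<noteq> {#}) sequentially"
    and unit: "\<And>m a. a \<in># A m \<Longrightarrow> cmod a = 1"
    and lim: "\<And>f :: complex \<Rightarrow> real. continuous_on UNIV f \<Longrightarrow>
      (\<lambda>m. avg f (A m)) \<longlonglongrightarrow> (\<integral>z. f z \<partial>circle_haar)"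
    and arc: "circle_arc I l"
  shows "(\<lambda>m. avg (\<lambda>u. of_bool (u \<in> I)) (A m)) \<longlonglongrightarrow> l / (2 * pi)"
proof (rule order_tendstoI)
  obtain a b where ab: "a \<le> b" "b \<le> a + 2 * pi" "l = b - a"
    and I: "I \<in> (`) cis ` {{a..b}, {a<..b}, {a..<b}, {a<..<b}}"
    using arc unfolding circle_arc_def by blast
  have le: "eventually (\<lambda>m. avg (\<lambda>u. of_bool (u \<in> cis ` {c..d})) (A m) < (d - c) / (2 * pi) + e) sequentially"
    if "c \<le> d" "0 < e" for c d e
  proof -
    have "compact (cis ` {c..d})"
      by (intro compact_continuous_image continuous_intros) auto
    then have "eventually (\<lambda>m. avg (\<lambda>u. of_bool (u \<in> cis ` {c..d})) (A m)
        < measure circle_haar (cis ` {c..d}) + e) sequentially"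
      using that by (intro avg_closed_less_eventually lim prob_space_circle_haar compact_imp_closed) auto
    then show ?thesis
      by eventually_elim (use measure_circle_haar_arc[OF that(1)] in linarith)
  qed
  have I_sub: "I \<subseteq> cis ` {a..b}" using I by auto
  have I_compl: "u \<in> I \<or> u \<in> cis ` {b..a + 2 * pi}" if u: "cmod u = 1" for u
  proof -
    obtain t where t: "a \<le> t" "t < a + 2 * pi" "u = cis t"
    proof -
      \<comment> \<open>The representative of the argument of \<open>u\<close> in \<open>[a, a + 2 \<pi>)\<close>.\<close>
      define s where "s = Arg u - 2 * pi * \<lfloor>(Arg u - a) / (2 * pi)\<rfloor>"
      have "cis s = cis (Arg u)"
        by (simp add: s_def cis_divide[symmetric] cis_multiple_2pi)
      also have "\<dots> = u" using u cis_Arg[of u] by (cases "u = 0") (auto simp: sgn_eq)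
      finally have "u = cis s" by simp
      moreover have "a \<le> s" "s < a + 2 * pi"
        using floor_divide_lower[of "2 * pi" "Arg u - a"] floor_divide_upper[of "2 * pi" "Arg u - a"]
        by (simp_all add: s_def algebra_simps)
      ultimately show thesis using that by blast
    qed
    have "cis (a + 2 * pi) = cis a" by (simp add: cis_mult[symmetric])
    then have a': "cis a \<in> cis ` {b..a + 2 * pi}" using ab by (metis atLeastAtMost_iff imageI order_refl)
    consider "t = a" | "a < t" "t < b" | "b \<le> t" using t by linarith
    then show ?thesis
    proof cases
      case 1 then show ?thesis using a' t by simp
    next
      case 2 then show ?thesis using I t by auto
    next
      case 3 then show ?thesis using t by auto
    qed
  qed
  {
    fix y assume "l / (2 * pi) < y"
    then have "eventually (\<lambda>m. avg (\<lambda>u. of_bool (u \<in> cis ` {a..b})) (A m)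
        < (b - a) / (2 * pi) + (y - l / (2 * pi))) sequentially"
      by (intro le ab) simp
    then show "eventually (\<lambda>m. avg (\<lambda>u. of_bool (u \<in> I)) (A m) < y) sequentially"
    proof eventually_elim
      case (elim m)
      have "avg (\<lambda>u. of_bool (u \<in> I)) (A m) \<le> (avg (\<lambda>u. of_bool (u \<in> cis ` {a..b})) (A m) :: real)"
        using I_sub by (intro avg_mono) (simp add: of_bool_def subset_iff)
      with elim ab show ?case by simp
    qed
  }
  {
    fix y assume y: "y < l / (2 * pi)"
    then have "eventually (\<lambda>m. avg (\<lambda>u. of_bool (u \<in> cis ` {b..a + 2 * pi})) (A m)
        < (a + 2 * pi - b) / (2 * pi) + (l / (2 * pi) - y)) sequentially"
      by (intro le ab) simp
    then show "eventually (\<lambda>m. y < avg (\<lambda>u. of_bool (u \<in> I)) (A m)) sequentially"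
      using ne
    proof eventually_elim
      case (elim m)
      have "1 = avg (\<lambda>u. 1 :: real) (A m)" using elim by (simp add: avg_const)
      also have "\<dots> \<le> avg (\<lambda>u. of_bool (u \<in> I) + of_bool (u \<in> cis ` {b..a + 2 * pi})) (A m)"
        using I_compl unit by (intro avg_mono) (fastforce simp: of_bool_def)
      also have "\<dots> = avg (\<lambda>u. of_bool (u \<in> I)) (A m) + avg (\<lambda>u. of_bool (u \<in> cis ` {b..a + 2 * pi})) (A m)"
        by (rule avg_add)
      moreover have "(a + 2 * pi - b) / (2 * pi) = 1 - l / (2 * pi)"
        using ab by (simp add: field_simps)
      ultimately show ?case using elim(1) by linarith
    qed
  }
qed

section \<open>Radial projection to the circle\<close>

text \<open>
Near the circle \<open>a\<close> and \<open>sgn a\<close> are close and \<open>f\<close> is uniformly continuous there; the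
remaining points have proportion tending to \<open>0\<close>, and on them the bounds on \<open>f\<close> suffice. Continuity is
required away from \<open>0\<close> only, because the lemma is applied to negative powers as well as to
test functions.
\<close>
lemma avg_diff_sgn_tendsto_0:
  fixes A :: "nat \<Rightarrow> complex multiset" and f :: "complex \<Rightarrow> 'b :: real_normed_field"
  assumes ne: "eventually (\<lambda>m. A m \<noteq> {#}) sequentially"
    and conc: "\<And>\<epsilon>. 0 < \<epsilon> \<Longrightarrow>
      (\<lambda>m. avg (\<lambda>a. of_bool (\<not> (1 - \<epsilon> < cmod a \<and> cmod a < 1 + \<epsilon>))) (A m) :: real) \<longlonglongrightarrow> 0"
    and nz: "\<And>m a. a \<in># A m \<Longrightarrow> a \<noteq> 0"
    and cont: "continuous_on (- {0}) f"
    and bdd: "\<And>m a. a \<in># A m \<Longrightarrow> norm (f a) \<le> B"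
  shows "(\<lambda>m. avg f (A m) - avg (\<lambda>a. f (sgn a)) (A m)) \<longlonglongrightarrow> 0"
proof (rule tendstoI)
  fix e :: real assume e: "0 < e"
  \<comment> \<open>A compact annulus that contains the circle and avoids \<open>0\<close>.\<close>
  define R :: "complex set" where "R = cball 0 2 - ball 0 (1/2)"
  have R: "z \<in> R \<longleftrightarrow> 1/2 \<le> cmod z \<and> cmod z \<le> 2" for z
    by (auto simp: R_def)
  have contR: "continuous_on R f"
    by (rule continuous_on_subset[OF cont]) (auto simp: R_def)
  have compR: "compact R"
    unfolding R_def by (intro compact_diff) auto
  obtain B' where B': "\<And>z. z \<in> R \<Longrightarrow> norm (f z) \<le> B'"
    using compact_imp_bounded[OF compact_continuous_image[OF contR compR]]
    unfolding bounded_iff by auto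
  obtain d where d: "0 < d" "\<And>z w. z \<in> R \<Longrightarrow> w \<in> R \<Longrightarrow> dist w z < d \<Longrightarrow> dist (f w) (f z) < e / 2"
    using compact_uniformly_continuous[OF contR compR] e
    unfolding uniformly_continuous_on_def by (meson half_gt_zero)
  define \<epsilon> where "\<epsilon> = min d (1/2)"
  define K where "K = \<bar>B\<bar> + \<bar>B'\<bar> + 1"
  define far where "far = (\<lambda>a. \<not> (1 - \<epsilon> < cmod a \<and> cmod a < 1 + \<epsilon>))"
  have \<epsilon>: "0 < \<epsilon>" "\<epsilon> \<le> d" "\<epsilon> \<le> 1/2" using d by (auto simp: \<epsilon>_def)
  have K: "0 < K" by (simp add: K_def)
  have bound: "norm (f a - f (sgn a)) \<le> e / 2 + K * of_bool (far a)" if a: "a \<in># A m" for a m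
  proof -
    have sgnR: "sgn a \<in> R" using nz[OF a] by (simp add: R norm_sgn)
    show ?thesis
    proof (cases "far a")
      case True
      have "norm (f a - f (sgn a)) \<le> norm (f a) + norm (f (sgn a))" by (rule norm_triangle_ineq4)
      also have "\<dots> \<le> K" using bdd[OF a] B'[OF sgnR] by (simp add: K_def)
      finally show ?thesis using True e by simp
    next
      case False
      then have aR: "a \<in> R" using \<epsilon> by (auto simp: far_def R)
      have "a - sgn a = of_real (cmod a - 1) * sgn a"
      proof -
        have "of_real (cmod a) * sgn a = a" using nz[OF a] by (simp add: sgn_eq)
        then show ?thesis by (simp add: left_diff_distrib)
      qed
      then have "dist a (sgn a) = \<bar>cmod a - 1\<bar>"
        unfolding dist_norm by (simp only: norm_mult norm_of_real norm_sgn nz[OF a] if_False mult_1_right)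
      also have "\<dots> < d" using False \<epsilon> by (auto simp: far_def)
      finally show ?thesis using d(2)[OF sgnR aR] False by (simp add: dist_norm less_imp_le)
    qed
  qed
  have "(\<lambda>m. K * avg (\<lambda>a. of_bool (far a)) (A m)) \<longlonglongrightarrow> K * 0"
    unfolding far_def by (intro tendsto_mult tendsto_const conc \<epsilon>)
  then have "eventually (\<lambda>m. K * avg (\<lambda>a. of_bool (far a)) (A m) < e / 2) sequentially"
    by (rule order_tendstoD) (use e in auto)
  then show "eventually (\<lambda>m. dist (avg f (A m) - avg (\<lambda>a. f (sgn a)) (A m)) 0 < e) sequentially"
    using ne
  proof eventually_elim
    case (elim m)
    have "norm (avg f (A m) - avg (\<lambda>a. f (sgn a)) (A m)) \<le> avg (\<lambda>a. e / 2 + K * of_bool (far a)) (A m)"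
      unfolding avg_diff[symmetric] by (rule norm_avg_le) (rule bound)
    also have "\<dots> = e / 2 + K * avg (\<lambda>a. of_bool (far a)) (A m)"
      by (simp only: avg_add avg_cmult avg_const[OF elim(2)])
    finally show ?case using elim(1) by simp
  qed
qed

section \<open>The polynomials \<open>\<Psi>\<^sub>m\<close> and their zeros\<close>

lemma coeff_Psi_triangular:
  assumes "k \<le> m"
  shows "coeff (Psi m) (k * (k + 1) div 2) = (-1) ^ k * of_nat (2 * k + 1)"
proof -
  have inj: "j * (j + 1) div 2 = k * (k + 1) div 2 \<longleftrightarrow> j = k" for j
    using triangle_strict_mono[of j k] triangle_strict_mono[of k j]
    by (cases j k rule: linorder_cases) auto
  show ?thesis
    unfolding Psi_def coeff_sum coeff_monom inj using assms by (simp add: sum.delta)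
qed

lemma coeff_Psi_0: "coeff (Psi m) 0 = 1"
  using coeff_Psi_triangular[of 0 m] by simp

lemma lead_coeff_Psi: "1 \<le> cmod (lead_coeff (Psi m))"
proof -
  have "lead_coeff (Psi m) = (-1) ^ m * of_nat (2 * m + 1)"
    using coeff_Psi_triangular[of m m] by (simp only: degree_Psi Psi_deg_def)
  then have "cmod (lead_coeff (Psi m)) = real (2 * m + 1)"
    by (simp only: norm_mult norm_power norm_of_nat) simp
  then show ?thesis by simp
qed

text \<open>
Any bound \<open>C\<^sup>i\<close> that does not depend on \<open>m\<close> would do: it bounds the power sums as well as the zeros
away from \<open>0\<close>.
\<close>
lemma cmod_coeff_Psi_le: "cmod (coeff (Psi m) i) \<le> 3 ^ i"
proof -
  define S where "S = {k \<in> {0..m}. k * (k + 1) div 2 = i}"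
  have "coeff (Psi m) i = (\<Sum>k\<in>S. (-1) ^ k * of_nat (2 * k + 1))"
    unfolding Psi_def coeff_sum coeff_monom S_def by (rule sum.inter_filter[symmetric]) simp
  moreover have "k = l" if "k \<in> S" "l \<in> S" for k l
    using that triangle_strict_mono[of k l] triangle_strict_mono[of l k]
    by (cases k l rule: linorder_cases) (auto simp: S_def)
  then have "S = {} \<or> (\<exists>k. S = {k})" by blast
  moreover have "cmod ((-1) ^ k * of_nat (2 * k + 1)) \<le> 3 ^ i" if "k \<in> S" for k
  proof -
    have "k \<le> i"
    proof (cases k)
      case (Suc j)
      have "2 * k \<le> k * (k + 1)" using Suc by simp
      then have "k \<le> k * (k + 1) div 2" by linarith
      then show ?thesis using that by (simp add: S_def)
    qed simp
    have "2 * k + 1 \<le> 3 ^ k" by (induction k) auto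
    also have "\<dots> \<le> (3 :: nat) ^ i" using \<open>k \<le> i\<close> by (intro power_increasing) auto
    finally have "real (2 * k + 1) \<le> real (3 ^ i)" by (rule of_nat_mono)
    then show ?thesis by (simp add: norm_mult norm_power del: of_nat_add of_nat_mult of_nat_Suc)
  qed
  ultimately show ?thesis by auto
qed

lemma cmod_poly_Psi_le:
  assumes "cmod z = 1"
  shows "cmod (poly (Psi m) z) \<le> real (m + 1) ^ 2"
proof -
  have "cmod (poly (Psi m) z) \<le> (\<Sum>k=0..m. real (2 * k + 1))"
    unfolding Psi_def poly_sum poly_monom
    by (rule sum_norm_le) (simp add: norm_mult norm_power assms del: of_nat_add of_nat_mult of_nat_Suc)
  also have "\<dots> = real (m + 1) ^ 2"
    by (induction m) (auto simp: power2_eq_square algebra_simps)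
  finally show ?thesis .
qed

lemma Psi_deg_gt_0: "1 \<le> m \<Longrightarrow> 0 < Psi_deg m"
  using triangle_strict_mono[of 0 m] by (simp add: Psi_deg_def)

lemma real_Psi_deg: "real (Psi_deg m) = real m * (real m + 1) / 2"
proof -
  have "real (m * (m + 1) div 2) = real (m * (m + 1)) / 2"
    by (subst real_of_nat_div) auto
  then show ?thesis by (simp add: Psi_deg_def algebra_simps)
qed

lemma size_roots_Psi: "size (proots (Psi m)) = Psi_deg m"
  by (simp add: size_proots_complex degree_Psi)

lemma roots_Psi_eventually_nonempty: "eventually (\<lambda>m. proots (Psi m) \<noteq> {#}) sequentially"
proof (rule eventually_sequentiallyI)
  fix m :: nat assume "1 \<le> m"
  then have "size (proots (Psi m)) \<noteq> 0" using Psi_deg_gt_0 by (simp add: size_roots_Psi)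
  then show "proots (Psi m) \<noteq> {#}" by auto
qed

lemma Psi_roots_bounded_below:
  assumes "a \<in># proots (Psi m)"
  shows "1 / 6 \<le> cmod a"
proof -
  have "poly (Psi m) a = 0" using assms by (cases "Psi m = 0") auto
  then show ?thesis
    using root_norm_lower_bound[OF coeff_Psi_0 cmod_coeff_Psi_le, of m a] by simp
qed

text \<open>
The bound \<open>(m + 1)\<^sup>2\<close> on the circle allows at most \<open>4 log (m + 1) / log (1 + \<epsilon>)\<close> exceptional
zeros, which is negligible against \<open>m (m + 1) / 2\<close>.
\<close>
lemma Psi_roots_off_circle_tendsto:
  assumes "0 < \<epsilon>"
  shows "(\<lambda>m. avg (\<lambda>a. of_bool (\<not> (1 - \<epsilon> < cmod a \<and> cmod a < 1 + \<epsilon>))) (proots (Psi m)) :: real) \<longlonglongrightarrow> 0"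
proof -
  define far where "far = (\<lambda>a. \<not> (1 - \<epsilon> < cmod a \<and> cmod a < 1 + \<epsilon>))"
  define N where "N = (\<lambda>m. size (filter_mset far (proots (Psi m))))"
  have N: "real (N m) \<le> 4 * ln (real m + 1) / ln (1 + \<epsilon>)" for m
  proof -
    have "(1 + \<epsilon>) ^ N m \<le> (real (m + 1) ^ 2)\<^sup>2"
      unfolding N_def far_def
      by (rule off_circle_roots_count[OF cmod_poly_Psi_le coeff_Psi_0 lead_coeff_Psi assms])
    then have "ln ((1 + \<epsilon>) ^ N m) \<le> ln (real (m + 1) ^ 4)"
      using assms by (subst ln_le_cancel_iff) auto
    then have "real (N m) * ln (1 + \<epsilon>) \<le> 4 * ln (real m + 1)"
      using assms by (simp add: ln_realpow add.commute)
    then show ?thesis using assms by (simp add: pos_le_divide_eq)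
  qed
  have "(\<lambda>m. real (N m) / real (Psi_deg m)) \<longlonglongrightarrow> 0"
  proof (rule tendsto_sandwich)
    show "eventually (\<lambda>m. 0 \<le> real (N m) / real (Psi_deg m)) sequentially" by simp
    show "eventually (\<lambda>m. real (N m) / real (Psi_deg m)
        \<le> 4 * ln (real m + 1) / ln (1 + \<epsilon>) / (real m * (real m + 1) / 2)) sequentially"
      unfolding real_Psi_deg by (intro always_eventually allI divide_right_mono N) auto
    have "(\<lambda>m. ln (real m + 1) / (real m * (real m + 1) / 2)) \<longlonglongrightarrow> 0" by real_asymp
    then have "(\<lambda>m. (4 / ln (1 + \<epsilon>)) * (ln (real m + 1) / (real m * (real m + 1) / 2))) \<longlonglongrightarrow> (4 / ln (1 + \<epsilon>)) * 0"
      by (intro tendsto_mult tendsto_const)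
    then show "(\<lambda>m. 4 * ln (real m + 1) / ln (1 + \<epsilon>) / (real m * (real m + 1) / 2)) \<longlonglongrightarrow> 0"
      by (simp add: mult_ac)
  qed auto
  then show ?thesis
    by (simp add: avg_of_bool N_def far_def size_roots_Psi)
qed

text \<open>
The power sums of the inverse zeros are bounded, so their averages vanish in the limit. Normalising the
zeros changes these averages by \<open>o(1)\<close>, and on the circle inversion is complex conjugation, which turns
negative powers into positive ones.
\<close>
lemma Psi_roots_arg_moments:
  assumes "1 \<le> k"
  shows "(\<lambda>m. avg (\<lambda>u. u ^ k) (image_mset sgn (proots (Psi m)))) \<longlonglongrightarrow> 0"
proof -
  define R where "R = (\<lambda>m. proots (Psi m))"
  have nz: "a \<noteq> 0" if "a \<in># R m" for a m
    using root_nonzero[of "Psi m"] that by (simp add: R_def coeff_Psi_0)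
  have ne: "eventually (\<lambda>m. R m \<noteq> {#}) sequentially"
    unfolding R_def by (rule roots_Psi_eventually_nonempty)
  \<comment> \<open>Without this bound the few zeros off the circle could dominate the average.\<close>
  have "norm (inverse a ^ k) \<le> 6 ^ k" if "a \<in># R m" for a m
  proof -
    have "inverse (cmod a) \<le> inverse (1 / 6)"
      using Psi_roots_bounded_below that by (intro le_imp_inverse_le) (auto simp: R_def)
    then show ?thesis by (simp add: norm_power norm_inverse power_mono)
  qed
  then have 1: "(\<lambda>m. avg (\<lambda>a. inverse a ^ k) (R m) - avg (\<lambda>a. inverse (sgn a) ^ k) (R m)) \<longlonglongrightarrow> 0"
    using Psi_roots_off_circle_tendsto nz
    by (intro avg_diff_sgn_tendsto_0[OF ne]) (auto simp: R_def intro!: continuous_intros)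
  obtain K where K: "\<And>m. cmod (\<Sum>a\<in>#R m. inverse a ^ k) \<le> K"
    using inverse_power_sums_bounded[where p = Psi and b = "\<lambda>i. 3 ^ i" and k = "k - 1", OF coeff_Psi_0 cmod_coeff_Psi_le] assms
    by (auto simp: R_def)
  have "(\<lambda>m. avg (\<lambda>a. inverse a ^ k) (R m)) \<longlonglongrightarrow> 0"
  proof (rule Lim_null_comparison)
    show "eventually (\<lambda>m. norm (avg (\<lambda>a. inverse a ^ k) (R m)) \<le> K * (1 / (real m * (real m + 1) / 2))) sequentially"
    proof (intro always_eventually allI)
      fix m
      have sz: "real (size (R m)) = real m * (real m + 1) / 2"
        by (simp add: R_def size_roots_Psi real_Psi_deg)
      then show "norm (avg (\<lambda>a. inverse a ^ k) (R m)) \<le> K * (1 / (real m * (real m + 1) / 2))"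
        using divide_right_mono[OF K[of m], of "real (size (R m))"]
        unfolding avg_def norm_divide norm_of_nat sz by simp
    qed
    have "(\<lambda>m. 1 / (real m * (real m + 1) / 2)) \<longlonglongrightarrow> 0" by real_asymp
    then show "(\<lambda>m. K * (1 / (real m * (real m + 1) / 2))) \<longlonglongrightarrow> 0"
      by (rule tendsto_mult_right_zero)
  qed
  from tendsto_diff[OF this 1] have "(\<lambda>m. avg (\<lambda>a. inverse (sgn a) ^ k) (R m)) \<longlonglongrightarrow> 0" by simp
  then have "(\<lambda>m. cnj (avg (\<lambda>a. inverse (sgn a) ^ k) (R m))) \<longlonglongrightarrow> cnj 0" by (rule tendsto_cnj)
  moreover have "cnj (avg (\<lambda>a. inverse (sgn a) ^ k) (R m)) = avg (\<lambda>a. sgn a ^ k) (R m)" for m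
    unfolding avg_cnj[symmetric]
  proof (rule avg_cong)
    fix a assume "a \<in># R m"
    then have "cmod (sgn a) = 1" using nz by (simp add: norm_sgn)
    then have "sgn a * cnj (sgn a) = 1" using complex_norm_square[of "sgn a"] by simp
    then have "inverse (sgn a) = cnj (sgn a)" by (rule inverse_unique)
    then show "cnj (inverse (sgn a) ^ k) = sgn a ^ k" by simp
  qed
  ultimately show ?thesis by (simp add: avg_image_mset R_def)
qed

lemma sum_mset_eq_sum_count:
  fixes f :: "'a \<Rightarrow> real"
  shows "(\<Sum>x\<in>#M. f x) = (\<Sum>x\<in>set_mset M. f x * real (count M x))"
proof -
  have "(\<Sum>x\<in>#M. f x) = (\<Sum>x\<in>S. f x * real (count M x))" if "finite S" "set_mset M \<subseteq> S" for S
    using that(2)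
  proof (induction M)
    case (add y M)
    have "(\<Sum>x\<in>S. f x * real (count (add_mset y M) x)) =
        (\<Sum>x\<in>S. f x * real (count M x) + (if x = y then f x else 0))"
      by (intro sum.cong) (auto simp: algebra_simps)
    with add that(1) show ?case by (simp add: sum.distrib)
  qed simp
  from this[of "set_mset M"] show ?thesis by simp
qed

text \<open>
The zero measure is the distribution of a zero drawn uniformly from the multiset of zeros, which reduces
the integral to a finite sum.
\<close>
lemma integral_zero_measure:
  fixes f :: "complex \<Rightarrow> real"
  assumes m: "1 \<le> m" and f: "f \<in> borel_measurable borel"
  shows "(\<integral>z. f z \<partial>zero_measure m) = avg f (proots (Psi m))"
proof -
  define P where "P = pmf_of_multiset (proots (Psi m))"
  have size: "size (proots (Psi m)) = Psi_deg m"
    by (rule size_roots_Psi)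
  have deg: "Psi_deg m \<noteq> 0"
    using Psi_deg_gt_0[OF m] by simp
  then have ne: "proots (Psi m) \<noteq> {#}"
    using size by auto
  have fin: "finite (set_pmf P)"
    using ne by (simp add: P_def)
  have expect: "measure_pmf.expectation P g = avg g (proots (Psi m))" for g :: "complex \<Rightarrow> real"
  proof -
    have "measure_pmf.expectation P g = (\<Sum>a\<in>set_mset (proots (Psi m)). g a * pmf P a)"
      using ne by (intro integral_measure_pmf_real) (auto simp: P_def)
    also have "\<dots> = avg g (proots (Psi m))"
      using ne by (simp add: sum_mset_eq_sum_count P_def sum_divide_distrib avg_def)
    finally show ?thesis .
  qed
  have eq: "zero_measure m = distr (measure_pmf P) borel (\<lambda>z. z)"
  proof (rule measure_eqI)
    fix X assume "X \<in> sets (zero_measure m)"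
    then have X: "X \<in> sets borel" by simp
    have sum: "(\<Sum>\<alpha>\<in>#B. emeasure (return borel \<alpha>) X) = ennreal (\<Sum>\<alpha>\<in>#B. indicator X \<alpha>)" for B
    proof (induction B)
      case (add x B)
      have "0 \<le> (\<Sum>\<alpha>\<in>#B. indicator X \<alpha> :: real)" by (induction B) auto
      with add X show ?case by (simp add: ennreal_plus ennreal_indicator)
    qed simp
    have "emeasure (distr (measure_pmf P) borel (\<lambda>z. z)) X = emeasure (measure_pmf P) X"
      using X by (subst emeasure_distr) auto
    also have "\<dots> = ennreal (measure_pmf.prob P X)"
      by (simp add: measure_pmf.emeasure_eq_measure)
    also have "measure_pmf.prob P X = measure_pmf.expectation P (indicator X)"
      by simp
    also have "\<dots> = (\<Sum>\<alpha>\<in>#proots (Psi m). indicator X \<alpha>) / real (Psi_deg m)"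
      unfolding expect avg_def size ..
    also have "ennreal \<dots> = ennreal (\<Sum>\<alpha>\<in>#proots (Psi m). indicator X \<alpha>) / of_nat (Psi_deg m)"
    proof -
      have "0 \<le> (\<Sum>\<alpha>\<in>#B. indicator X \<alpha> :: real)" for B by (induction B) auto
      then show ?thesis
        using deg by (simp add: divide_ennreal[symmetric] ennreal_of_nat_eq_real_of_nat)
    qed
    finally show "emeasure (zero_measure m) X = emeasure (distr (measure_pmf P) borel (\<lambda>z. z)) X"
      unfolding emeasure_zero_measure[OF X] sum by (rule sym)
  qed simp
  have "(\<integral>z. f z \<partial>zero_measure m) = measure_pmf.expectation P f"
    unfolding eq using f by (subst integral_distr) auto
  also have "\<dots> = avg f (proots (Psi m))"
    by (rule expect)
  finally show ?thesis .
qed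

theorem theorem4p1:
  shows "weak_star_converges zero_measure circle_haar
    \<and> (\<forall>I l. circle_arc I l \<longrightarrow>
         (\<lambda>m. real (zero_count m (\<lambda>\<alpha>. \<alpha> / of_real (cmod \<alpha>) \<in> I)) / real (Psi_deg m))
           \<longlonglongrightarrow> l / (2 * pi))
    \<and> (\<forall>\<epsilon>>0. (\<lambda>m. real (zero_count m (\<lambda>\<alpha>. \<not> (1 - \<epsilon> < cmod \<alpha> \<and> cmod \<alpha> < 1 + \<epsilon>))))
         \<in> o(\<lambda>m. real (Psi_deg m)))"
proof -
  define R where "R = (\<lambda>m. proots (Psi m))"
  define U where "U = (\<lambda>m. image_mset sgn (R m))"
  have nz: "a \<noteq> 0" if "a \<in># R m" for a m
    using root_nonzero[of "Psi m"] that by (simp add: R_def coeff_Psi_0)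
  have unit: "cmod u = 1" if "u \<in># U m" for u m
    using nz that by (auto simp: U_def norm_sgn)
  have size: "size (R m) = Psi_deg m" for m
    by (simp add: R_def size_roots_Psi)
  have ne: "eventually (\<lambda>m. R m \<noteq> {#}) sequentially"
    unfolding R_def by (rule roots_Psi_eventually_nonempty)
  then have neU: "eventually (\<lambda>m. U m \<noteq> {#}) sequentially"
    by (simp add: U_def)
  have count: "real (zero_count m P) / real (Psi_deg m) = avg (\<lambda>a. of_bool (P a)) (R m)" for m P
    by (simp add: zero_count_def avg_of_bool size[symmetric]) (simp add: R_def)
  have lim: "(\<lambda>m. avg f (U m)) \<longlonglongrightarrow> (\<integral>z. f z \<partial>circle_haar)" if "continuous_on UNIV f"
    for f :: "complex \<Rightarrow> real"
    using unit neU Psi_roots_arg_moments that unfolding U_def R_def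
    by (intro weyl_criterion_circle) blast+
  have "weak_star_converges zero_measure circle_haar"
    unfolding weak_star_converges_def
  proof (intro allI impI)
    fix f :: "complex \<Rightarrow> real" assume "continuous_on UNIV f \<and> bounded (range f)"
    then have f: "continuous_on UNIV f" "bounded (range f)" by auto
    obtain B where "\<And>z. norm (f z) \<le> B" using f(2) by (auto simp: bounded_iff)
    then have "(\<lambda>m. avg f (R m) - avg (\<lambda>a. f (sgn a)) (R m)) \<longlonglongrightarrow> 0"
      using Psi_roots_off_circle_tendsto nz f(1)
      by (intro avg_diff_sgn_tendsto_0[OF ne]) (auto simp: R_def intro: continuous_on_subset)
    from tendsto_add[OF this lim[OF f(1)]] have "(\<lambda>m. avg f (R m)) \<longlonglongrightarrow> (\<integral>z. f z \<partial>circle_haar)"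
      by (simp add: U_def avg_image_mset)
    moreover have "eventually (\<lambda>m. avg f (R m) = (\<integral>z. f z \<partial>zero_measure m)) sequentially"
      using f(1) unfolding R_def
      by (intro eventually_sequentiallyI[of 1] integral_zero_measure[symmetric] borel_measurable_continuous_onI)
    ultimately show "(\<lambda>m. \<integral>z. f z \<partial>zero_measure m) \<longlonglongrightarrow> (\<integral>z. f z \<partial>circle_haar)"
      by (rule Lim_transform_eventually)
  qed
  moreover have "(\<lambda>m. real (zero_count m (\<lambda>\<alpha>. \<alpha> / of_real (cmod \<alpha>) \<in> I)) / real (Psi_deg m))
      \<longlonglongrightarrow> l / (2 * pi)" if "circle_arc I l" for I l
    using avg_arc_tendsto[OF neU unit lim that]
    by (simp add: count U_def avg_image_mset sgn_eq)
  moreover have "(\<lambda>m. real (zero_count m (\<lambda>\<alpha>. \<not> (1 - \<epsilon> < cmod \<alpha> \<and> cmod \<alpha> < 1 + \<epsilon>))))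
      \<in> o(\<lambda>m. real (Psi_deg m))" if "0 < \<epsilon>" for \<epsilon>
  proof (rule smalloI_tendsto)
    show "(\<lambda>m. real (zero_count m (\<lambda>\<alpha>. \<not> (1 - \<epsilon> < cmod \<alpha> \<and> cmod \<alpha> < 1 + \<epsilon>))) / real (Psi_deg m))
        \<longlonglongrightarrow> 0"
      unfolding count R_def by (rule Psi_roots_off_circle_tendsto[OF that])
    show "eventually (\<lambda>m. real (Psi_deg m) \<noteq> 0) sequentially"
      using Psi_deg_gt_0 by (intro eventually_sequentiallyI[of 1]) fastforce
  qed
  ultimately show ?thesis by blast
qed

end
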